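(* Let $\mu$ be a quasi-definite complex Borel measure on $\mathbb T$ and let $J=S_1\Upsilon S_1^{-1}$ be its CMV Jacobi type matrix. 1. The only possibly non-vanishing entries of $J$ are, for $k\ge0$ (entries with a negative index being omitted), $$J_{2k,2k-1}=-\rho_{2k}^2\alpha_{2k+1}^{(1)},\quad J_{2k,2k}=-\bar\alpha_{2k}^{(2)}\alpha_{2k+1}^{(1)},\quad J_{2k,2k+1}=-\alpha_{2k+2}^{(1)},\quad J_{2k,2k+2}=1,$$ $$J_{2k+1,2k-1}=\rho_{2k+1}^2\rho_{2k}^2,\quad J_{2k+1,2k}=\rho_{2k+1}^2\bar\alpha_{2k}^{(2)},\quad J_{2k+1,2k+1}=-\bar\alpha_{2k+1}^{(2)}\alpha_{2k+2}^{(1)},\quad J_{2k+1,2k+2}=\bar\alpha_{2k+1}^{(2)}.$$ 2. For $k\ge0$ (with $\varphi_1^{(-1)}:=0$) the recursion relations $$z\varphi_1^{(2k)}=\varphi_1^{(2k+2)}-\alpha_{2k+2}^{(1)}\varphi_1^{(2k+1)}-\bar\alpha_{2k}^{(2)}\alpha_{2k+1}^{(1)}\varphi_1^{(2k)}-\rho_{2k}^2\alpha_{2k+1}^{(1)}\varphi_1^{(2k-1)},$$ $$z\varphi_1^{(2k+1)}=\bar\alpha_{2k+1}^{(2)}\varphi_1^{(2k+2)}-\bar\alpha_{2k+1}^{(2)}\alpha_{2k+2}^{(1)}\varphi_1^{(2k+1)}+\rho_{2k+1}^2\bar\alpha_{2k}^{(2)}\varphi_1^{(2k)}+\rho_{2k+1}^2\rho_{2k}^2\varphi_1^{(2k-1)}$$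 hold.
   Context: $\mathbb T$ is the unit circle; $\mu$ is quasi-definite if all Toeplitz matrices $\big(\oint_{\mathbb T}z^{i-j}d\mu\big)_{i,j=0}^n$, $n\ge0$, are non-singular. Indices start at $0$; $\dagger$ is the conjugate transpose; a bar over a scalar is complex conjugation, a bar over a polynomial conjugates only its coefficients. $\chi(z)=(1,z^{-1},z,z^{-2},z^2,\dots)^\top$; $g=\oint_{\mathbb T}\chi\chi^\dagger d\mu=S_1^{-1}S_2$ with $S_1$ lower unitriangular, $S_2$ upper triangular (unique). $\varphi_1^{(l)}=(S_1\chi)^{(l)}$. $h_l:=(S_2)_{ll}$, $\rho_0^2:=0$, $\rho_l^2:=h_l/h_{l-1}$ for $l\ge1$. $P_l^{(1)}$, $P_l^{(2)}$ are the unique monic polynomials of degree $l$ with $\oint_{\mathbb T}P_l^{(1)}(z)z^{-k}d\mu=0$ and $\oint_{\mathbb T}z^k\bar P_l^{(2)}(z^{-1})d\mu=0$ for $k=0,\dots,l-1$; Verblunsky coefficients $\alpha_l^{(a)}:=P_l^{(a)}(0)$ (so $\alpha_0^{(a)}=1$). $\Upsilon$ is the semi-infinite matrix whose only non-zero entries are $\Upsilon_{2j,2j+2}=1$, $\Upsilon_{2j+3,2j+1}=1$ ($j\ge0$) and $\Upsilon_{1,0}=1$; it satisfies $\Upsilon\chi(z)=z\chi(z)$. *)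

theory Defs
  imports "HOL-Analysis.Analysis" "Jordan_Normal_Form.Determinant"
begin

section \<open>Complex measures and integration\<close>

text \<open>
  A complex measure on a measurable space \<open>M\<close> (only \<open>space M\<close> and \<open>sets M\<close> matter) is a
  countably additive complex-valued set function; its values outside \<open>sets M\<close> are irrelevant.
\<close>

definition complex_measure :: "'a measure \<Rightarrow> ('a set \<Rightarrow> complex) \<Rightarrow> bool" where
  "complex_measure M \<mu> \<longleftrightarrow>
     (\<forall>A :: nat \<Rightarrow> 'a set. range A \<subseteq> sets M \<longrightarrow> disjoint_family A \<longrightarrow>
        (\<lambda>n. \<mu> (A n)) sums \<mu> (\<Union>n. A n))"

text \<open>
  The positive part of the Jordan decomposition of a signed measure \<open>\<nu>\<close>,
  \<open>\<nu>\<^sup>+ A = sup {\<nu> B | B \<subseteq> A measurable}\<close>. The truncation of negative values by \<open>ennreal\<close> is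
  harmless, since \<open>B = {}\<close> already contributes 0. The negative part of \<open>\<nu>\<close> is the positive
  part of \<open>- \<nu>\<close>.
\<close>

definition jordan_pos :: "'a measure \<Rightarrow> ('a set \<Rightarrow> real) \<Rightarrow> 'a measure" where
  "jordan_pos M \<nu> = measure_of (space M) (sets M)
     (\<lambda>A. SUP B\<in>{B \<in> sets M. B \<subseteq> A}. ennreal (\<nu> B))"

definition cm_integral :: "'a measure \<Rightarrow> ('a set \<Rightarrow> complex) \<Rightarrow> ('a \<Rightarrow> complex) \<Rightarrow> complex" where
  "cm_integral M \<mu> f =
     ((LINT x|jordan_pos M (\<lambda>A. Re (\<mu> A)). f x) - (LINT x|jordan_pos M (\<lambda>A. - Re (\<mu> A)). f x))
     + \<i> * ((LINT x|jordan_pos M (\<lambda>A. Im (\<mu> A)). f x) - (LINT x|jordan_pos M (\<lambda>A. - Im (\<mu> A)). f x))"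

definition circle :: "complex measure" where
  "circle = restrict_space borel (sphere 0 1)"

definition circ_integral :: "(complex set \<Rightarrow> complex) \<Rightarrow> (complex \<Rightarrow> complex) \<Rightarrow> complex" where
  "circ_integral \<mu> f = cm_integral circle \<mu> f"

definition quasi_definite :: "(complex set \<Rightarrow> complex) \<Rightarrow> bool" where
  "quasi_definite \<mu> \<longleftrightarrow>
     (\<forall>n. Determinant.det (Matrix.mat (Suc n) (Suc n)
            (\<lambda>(i, j). circ_integral \<mu> (\<lambda>z. z powi (int i - int j)))) \<noteq> 0)"


section \<open>Semi-infinite matrices\<close>

type_synonym semimat = "nat \<Rightarrow> nat \<Rightarrow> complex"

text \<open>
  In every product used below each series has only finitely many non-zero terms.
\<close>

definition sm_mult :: "semimat \<Rightarrow> semimat \<Rightarrow> semimat" where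
  "sm_mult A B = (\<lambda>i j. \<Sum>k. A i k * B k j)"

definition sm_one :: semimat where
  "sm_one = (\<lambda>i j. if i = j then 1 else 0)"

definition sm_lower :: "semimat \<Rightarrow> bool" where
  "sm_lower A \<longleftrightarrow> (\<forall>i j. i < j \<longrightarrow> A i j = 0)"

definition sm_upper :: "semimat \<Rightarrow> bool" where
  "sm_upper A \<longleftrightarrow> (\<forall>i j. j < i \<longrightarrow> A i j = 0)"

definition sm_lower_unitri :: "semimat \<Rightarrow> bool" where
  "sm_lower_unitri A \<longleftrightarrow> sm_lower A \<and> (\<forall>i. A i i = 1)"

text \<open>
  Two-sided inverses of semi-infinite matrices need not be unique; for a lower triangular
  matrix with non-zero diagonal the inverse is the unique lower triangular one.
\<close>

definition sm_inv :: "semimat \<Rightarrow> semimat" where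
  "sm_inv A = (THE B. sm_lower B \<and> sm_mult A B = sm_one \<and> sm_mult B A = sm_one)"


section \<open>The CMV ordering and the factorization of the moment matrix\<close>

definition chi :: "complex \<Rightarrow> nat \<Rightarrow> complex" where
  "chi z l = (if even l then z powi int (l div 2) else z powi (- int ((l + 1) div 2)))"

definition Upsilon :: semimat where
  "Upsilon = (\<lambda>i j. if (even i \<and> j = i + 2) \<or> (odd j \<and> i = j + 2) \<or> (i = 1 \<and> j = 0)
                      then 1 else 0)"

definition moment_matrix :: "(complex set \<Rightarrow> complex) \<Rightarrow> semimat" where
  "moment_matrix \<mu> = (\<lambda>i j. circ_integral \<mu> (\<lambda>z. chi z i * cnj (chi z j)))"

definition CMV_factors :: "(complex set \<Rightarrow> complex) \<Rightarrow> semimat \<times> semimat" where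
  "CMV_factors \<mu> = (THE (S1, S2). sm_lower_unitri S1 \<and> sm_upper S2 \<and>
                       moment_matrix \<mu> = sm_mult (sm_inv S1) S2)"

definition CMV_S1 :: "(complex set \<Rightarrow> complex) \<Rightarrow> semimat" where
  "CMV_S1 \<mu> = fst (CMV_factors \<mu>)"

definition CMV_S2 :: "(complex set \<Rightarrow> complex) \<Rightarrow> semimat" where
  "CMV_S2 \<mu> = snd (CMV_factors \<mu>)"

definition phi1 :: "(complex set \<Rightarrow> complex) \<Rightarrow> nat \<Rightarrow> complex \<Rightarrow> complex" where
  "phi1 \<mu> l z = (\<Sum>k. CMV_S1 \<mu> l k * chi z k)"

definition CMV_h :: "(complex set \<Rightarrow> complex) \<Rightarrow> nat \<Rightarrow> complex" where
  "CMV_h \<mu> l = CMV_S2 \<mu> l l"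

text \<open>\<open>rho_sq \<mu> l\<close> is the complex number written \<open>\<rho>\<^sub>l\<^sup>2\<close>.\<close>

definition rho_sq :: "(complex set \<Rightarrow> complex) \<Rightarrow> nat \<Rightarrow> complex" where
  "rho_sq \<mu> l = (if l = 0 then 0 else CMV_h \<mu> l / CMV_h \<mu> (l - 1))"

definition CMV_J :: "(complex set \<Rightarrow> complex) \<Rightarrow> semimat" where
  "CMV_J \<mu> = sm_mult (sm_mult (CMV_S1 \<mu>) Upsilon) (sm_inv (CMV_S1 \<mu>))"


section \<open>Szego polynomials and Verblunsky coefficients\<close>

definition szego1 :: "(complex set \<Rightarrow> complex) \<Rightarrow> nat \<Rightarrow> complex poly" where
  "szego1 \<mu> l = (THE p. degree p = l \<and> lead_coeff p = 1 \<and>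
     (\<forall>k<l. circ_integral \<mu> (\<lambda>z. poly p z * z powi (- int k)) = 0))"

definition szego2 :: "(complex set \<Rightarrow> complex) \<Rightarrow> nat \<Rightarrow> complex poly" where
  "szego2 \<mu> l = (THE p. degree p = l \<and> lead_coeff p = 1 \<and>
     (\<forall>k<l. circ_integral \<mu> (\<lambda>z. z ^ k * poly (map_poly cnj p) (inverse z)) = 0))"

definition alpha1 :: "(complex set \<Rightarrow> complex) \<Rightarrow> nat \<Rightarrow> complex" where
  "alpha1 \<mu> l = poly (szego1 \<mu> l) 0"

definition alpha2 :: "(complex set \<Rightarrow> complex) \<Rightarrow> nat \<Rightarrow> complex" where
  "alpha2 \<mu> l = poly (szego2 \<mu> l) 0"

end

theory Submission
  imports Defs
begin

text \<open>
  All integrands are Laurent polynomials, so the measure enters only through its moments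
  \<open>c n = \<integral> z\<^sup>n d\<mu>\<close>; what has to be known about it is that integration is linear on Laurent
  polynomials. This needs a complex measure to be bounded (\<open>complex_measure_bounded\<close>), since the
  Lebesgue integrals that define \<open>cm_integral\<close> are additive only on integrable functions.

  Quasi-definiteness says that a polynomial of degree less than \<open>n\<close> can be prescribed, uniquely, by
  its pairings with \<open>z\<^sup>0, z\<^sup>-\<^sup>1, \<dots>, z\<^sup>-\<^sup>n\<^sup>+\<^sup>1\<close> (\<open>ex1_pairing\<close>). This yields two families:
  the monic \<open>P l\<close>, orthogonal to \<open>1, \<dots>, z\<^sup>l\<^sup>-\<^sup>1\<close>, and the polynomials \<open>R l\<close> of degree at most \<open>l\<close>
  with constant term 1, orthogonal to \<open>z, \<dots>, z\<^sup>l\<close>, which are the reversed conjugates of the second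
  family of Szego polynomials. With \<open>a l = P l (0)\<close> and \<open>b l\<close> the coefficient of \<open>z\<^sup>l\<close> in \<open>R l\<close>,
  that is \<open>\<alpha>\<^sub>l\<close> of the first kind and the conjugate of \<open>\<alpha>\<^sub>l\<close> of the second kind,
  comparison of degrees and orthogonality gives the Szego recursions
  \<open>P (l+1) = z P l + a (l+1) R l\<close> and \<open>R (l+1) = R l + b (l+1) z P l\<close>, and from them
  \<open>h (l+1) = h l (1 - a (l+1) b (l+1))\<close> for the pairing \<open>h l\<close> of \<open>P l\<close> with \<open>z\<^sup>-\<^sup>l\<close>, so that
  \<open>\<rho>\<^sub>l\<^sup>2 = 1 - a l b l\<close> for \<open>l \<ge> 1\<close>.

  The exponents of the first \<open>l + 1\<close> entries of \<open>\<chi>\<close> form an interval, so multiplication by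
  the power \<open>(l+1) div 2\<close> of \<open>z\<close> turns \<open>\<phi>\<^sub>l\<close> into a polynomial of degree at most \<open>l\<close>. Its
  normalization and orthogonality identify it as \<open>P l\<close> for even \<open>l\<close> and \<open>R l\<close> for odd \<open>l\<close>
  (\<open>S_gram_upper\<close>, \<open>factorization_unique\<close>). Two Szego steps then express \<open>z \<phi>\<^sub>l\<close> through its
  neighbours (\<open>phi_recursion_even\<close>, \<open>phi_recursion_odd\<close>). As \<open>\<Upsilon> \<chi> = z \<chi>\<close> and the functions in \<open>\<chi>\<close>
  are linearly independent, these recursions say \<open>S \<Upsilon> = J S\<close> for the banded matrix \<open>J\<close> of their
  coefficients, hence \<open>S \<Upsilon> S\<^sup>-\<^sup>1 = J\<close>.
\<close>

section \<open>Integrals of Laurent polynomials against a complex measure\<close>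

lemma complex_measure_empty:
  assumes "complex_measure M \<mu>"
  shows "\<mu> {} = 0"
proof -
  have "(\<lambda>n::nat. \<mu> {}) sums \<mu> (\<Union>n::nat. {})"
    using assms unfolding complex_measure_def by (elim allE[of _ "\<lambda>_. {}"]) (auto simp: disjoint_family_on_def)
  then show ?thesis
    using summable_LIMSEQ_zero[OF sums_summable] LIMSEQ_const_iff by blast
qed

lemma complex_measure_Un:
  assumes "complex_measure M \<mu>" "A \<in> sets M" "B \<in> sets M" "A \<inter> B = {}"
  shows "\<mu> (A \<union> B) = \<mu> A + \<mu> B"
proof -
  have "(\<lambda>n. \<mu> (binaryset A B n)) sums \<mu> (\<Union>n. binaryset A B n)"
    using assms unfolding complex_measure_def
    by (elim allE[of _ "binaryset A B"])
       (auto simp: disjoint_family_on_def binaryset_def range_binaryset_eq split: if_splits)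
  moreover have "(\<lambda>n. \<mu> (binaryset A B n)) sums (\<mu> A + \<mu> B)"
    by (rule binaryset_sums) (rule complex_measure_empty[OF assms(1)])
  ultimately show ?thesis
    using sums_unique2 by (metis UN_binaryset_eq)
qed

text \<open>
  A set on which the values are unbounded splits into two pieces of measure of modulus greater than 1,
  one of which is again unbounded. Repeating this inside the unbounded piece leaves a disjoint
  sequence of sets whose measures do not tend to 0, against countable additivity.
\<close>

lemma complex_measure_bounded:
  assumes cm: "complex_measure M \<mu>"
  shows "\<exists>C. \<forall>B\<in>sets M. norm (\<mu> B) \<le> C"
proof (rule ccontr)
  assume unbounded: "\<not> ?thesis"
  define unb where "unb X \<longleftrightarrow> X \<in> sets M \<and> (\<forall>C. \<exists>B\<in>sets M. B \<subseteq> X \<and> C < norm (\<mu> B))" for X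
  have split: "\<exists>Y. unb Y \<and> Y \<subseteq> X \<and> 1 < norm (\<mu> (X - Y))" if "unb X" for X
  proof -
    have X: "X \<in> sets M" and "\<exists>B\<in>sets M. B \<subseteq> X \<and> norm (\<mu> X) + 1 < norm (\<mu> B)"
      using that unfolding unb_def by simp_all
    then obtain B where B: "B \<in> sets M" "B \<subseteq> X" "norm (\<mu> X) + 1 < norm (\<mu> B)"
      by auto
    have "\<mu> (B \<union> (X - B)) = \<mu> B + \<mu> (X - B)"
      by (rule complex_measure_Un[OF cm]) (use B X in auto)
    moreover have "B \<union> (X - B) = X" using B(2) by auto
    ultimately have muX: "\<mu> X = \<mu> B + \<mu> (X - B)" by metis
    \<comment> \<open>\<open>B\<close> outweighs \<open>X\<close> by more than 1, and \<open>X - B\<close> has to compensate.\<close>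
    then have nB: "1 < norm (\<mu> (X - B))"
      using B(3) norm_diff_ineq[of "\<mu> B" "\<mu> (X - B)"] unfolding muX[symmetric] by linarith
    have "unb B \<or> unb (X - B)"
    proof (rule ccontr)
      assume "\<not> ?thesis"
      then obtain C1 C2 where C: "\<And>D. D \<in> sets M \<Longrightarrow> D \<subseteq> B \<Longrightarrow> norm (\<mu> D) \<le> C1"
        "\<And>D. D \<in> sets M \<Longrightarrow> D \<subseteq> X - B \<Longrightarrow> norm (\<mu> D) \<le> C2"
        using B X unfolding unb_def by (meson not_le sets.Diff)
      have "norm (\<mu> D) \<le> C1 + C2" if D: "D \<in> sets M" "D \<subseteq> X" for D
      proof -
        have "\<mu> ((D \<inter> B) \<union> (D - B)) = \<mu> (D \<inter> B) + \<mu> (D - B)"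
          by (rule complex_measure_Un[OF cm]) (use B D in auto)
        moreover have "(D \<inter> B) \<union> (D - B) = D" by auto
        ultimately have "\<mu> D = \<mu> (D \<inter> B) + \<mu> (D - B)" by metis
        moreover have "norm (\<mu> (D \<inter> B)) \<le> C1" "norm (\<mu> (D - B)) \<le> C2"
          using D B by (auto intro!: C)
        ultimately show ?thesis by (metis add_mono norm_triangle_le)
      qed
      then show False using that unfolding unb_def by (meson not_le)
    qed
    then show ?thesis
    proof
      assume "unb B" then show ?thesis using B nB by blast
    next
      assume u: "unb (X - B)"
      have "X - (X - B) = B" using B by auto
      moreover have "1 < norm (\<mu> B)" using B(3) norm_ge_zero[of "\<mu> X"] by linarith
      ultimately have "1 < norm (\<mu> (X - (X - B)))" by simp
      then show ?thesis using u by blast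
    qed
  qed
  have u0: "unb (space M)"
    unfolding unb_def
  proof (intro conjI allI)
    fix C
    obtain B where "B \<in> sets M" "C < norm (\<mu> B)" using unbounded by (meson not_le)
    then show "\<exists>B\<in>sets M. B \<subseteq> space M \<and> C < norm (\<mu> B)"
      using sets.sets_into_space by blast
  qed simp
  have "\<exists>f. \<forall>n::nat. unb (f n) \<and> (f (Suc n) \<subseteq> f n \<and> 1 < norm (\<mu> (f n - f (Suc n))))"
    by (rule dependent_nat_choice) (use u0 split in auto)
  then obtain f where chain:
    "\<forall>n::nat. unb (f n) \<and> (f (Suc n) \<subseteq> f n \<and> 1 < norm (\<mu> (f n - f (Suc n))))" ..
  have f: "unb (f n)" "f (Suc n) \<subseteq> f n" "1 < norm (\<mu> (f n - f (Suc n)))" for n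
    using spec[OF chain, of n] by simp_all
  define A where "A n = f n - f (Suc n)" for n
  have dec: "f n \<subseteq> f m" if "m \<le> n" for m n
    using lift_Suc_antimono_le[of f] f(2) that by blast
  have "A m \<inter> A n = {}" if "m < n" for m n
    using dec[of "Suc m" n] that unfolding A_def by auto
  then have "disjoint_family A"
    unfolding disjoint_family_on_def by (metis Int_commute nat_neq_iff)
  moreover have "range A \<subseteq> sets M" using f(1) unfolding A_def unb_def by auto
  ultimately have "(\<lambda>n. \<mu> (A n)) sums \<mu> (\<Union>n. A n)"
    using cm unfolding complex_measure_def by blast
  then have "(\<lambda>n. norm (\<mu> (A n))) \<longlonglongrightarrow> 0"
    using summable_LIMSEQ_zero[OF sums_summable] tendsto_norm_zero by blast
  then have "eventually (\<lambda>n. norm (\<mu> (A n)) < 1) sequentially"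
    by (rule order_tendstoD) simp
  then obtain n where "norm (\<mu> (A n)) < 1"
    unfolding eventually_sequentially by blast
  with f(3)[of n] show False unfolding A_def by linarith
qed

lemma space_jordan_pos: "space (jordan_pos M \<nu>) = space M"
  unfolding jordan_pos_def by (rule space_measure_of) (rule sets.space_closed)

lemma sets_jordan_pos: "sets (jordan_pos M \<nu>) = sets M"
  unfolding jordan_pos_def by (metis sets.sets_measure_of_eq)

text \<open>
  \<open>measure_of\<close> yields the null measure unless the supremum is countably additive, so a bound on
  the supremum is enough here.
\<close>

lemma finite_measure_jordan_pos:
  assumes "\<And>B. B \<in> sets M \<Longrightarrow> \<nu> B \<le> C"
  shows "finite_measure (jordan_pos M \<nu>)"
proof
  have "(SUP B\<in>{B \<in> sets M. B \<subseteq> space M}. ennreal (\<nu> B)) \<le> ennreal C"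
    using assms by (auto intro!: SUP_least ennreal_leI)
  then have "(SUP B\<in>{B \<in> sets M. B \<subseteq> space M}. ennreal (\<nu> B)) \<noteq> \<infinity>"
    by (metis ennreal_less_top infinity_ennreal_def linorder_not_less)
  then show "emeasure (jordan_pos M \<nu>) (space (jordan_pos M \<nu>)) \<noteq> \<infinity>"
    unfolding space_jordan_pos unfolding jordan_pos_def emeasure_measure_of_conv by auto
qed

lemma space_circle: "space circle = sphere 0 1"
  unfolding circle_def by (simp add: space_restrict_space)

lemma integrable_jordan_pos_circle:
  fixes f :: "complex \<Rightarrow> complex"
  assumes "\<And>B. B \<in> sets circle \<Longrightarrow> \<nu> B \<le> C" and f: "continuous_on (sphere 0 1) f"
  shows "integrable (jordan_pos circle \<nu>) f"
proof -
  interpret finite_measure "jordan_pos circle \<nu>"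
    by (rule finite_measure_jordan_pos) (rule assms)
  have "compact (f ` sphere 0 1)"
    using f by (intro compact_continuous_image) auto
  then obtain K where K: "\<And>z. z \<in> sphere 0 1 \<Longrightarrow> norm (f z) \<le> K"
    using compact_imp_bounded bounded_iff by (metis image_eqI)
  have "f \<in> borel_measurable circle"
    unfolding circle_def using f by (rule borel_measurable_continuous_on_restrict)
  then have "f \<in> borel_measurable (jordan_pos circle \<nu>)"
    using measurable_cong_sets[OF sets_jordan_pos refl] by blast
  then show ?thesis
    using K by (intro integrable_const_bound[of _ K] AE_I2) (auto simp: space_jordan_pos space_circle)
qed

text \<open>
  Both parts of the Jordan decompositions of \<open>Re \<mu>\<close> and \<open>Im \<mu>\<close> are finite measures because
  \<open>\<mu>\<close> is bounded; so continuous functions on the compact circle are integrable.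
\<close>

lemma circ_integral_sum:
  assumes cm: "complex_measure circle \<mu>"
    and f: "\<And>i. i \<in> I \<Longrightarrow> continuous_on (sphere 0 1) (f i)"
  shows "circ_integral \<mu> (\<lambda>z. \<Sum>i\<in>I. a i * f i z) = (\<Sum>i\<in>I. a i * circ_integral \<mu> (f i))"
proof -
  obtain C where C: "\<And>B. B \<in> sets circle \<Longrightarrow> norm (\<mu> B) \<le> C"
    using complex_measure_bounded[OF cm] by blast
  have sum: "(LINT z|jordan_pos circle \<nu>. (\<Sum>i\<in>I. a i * f i z)) =
      (\<Sum>i\<in>I. a i * (LINT z|jordan_pos circle \<nu>. f i z))"
    if "\<And>B. B \<in> sets circle \<Longrightarrow> \<nu> B \<le> norm (\<mu> B)" for \<nu>
  proof -
    have "integrable (jordan_pos circle \<nu>) (f i)" if "i \<in> I" for i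
      using C \<open>\<And>B. B \<in> sets circle \<Longrightarrow> \<nu> B \<le> norm (\<mu> B)\<close> f[OF that]
      by (intro integrable_jordan_pos_circle[of _ C]) (meson order_trans)+
    then show ?thesis by (subst Bochner_Integration.integral_sum) auto
  qed
  have parts: "Re w \<le> norm w" "- Re w \<le> norm w" "Im w \<le> norm w" "- Im w \<le> norm w" for w
    using abs_Re_le_cmod[of w] abs_Im_le_cmod[of w] by linarith+
  show ?thesis
    unfolding circ_integral_def cm_integral_def
      sum[of "\<lambda>A. Re (\<mu> A)", OF parts(1)] sum[of "\<lambda>A. - Re (\<mu> A)", OF parts(2)]
      sum[of "\<lambda>A. Im (\<mu> A)", OF parts(3)] sum[of "\<lambda>A. - Im (\<mu> A)", OF parts(4)]
    by (simp add: sum_distrib_left sum.distrib sum_subtractf right_diff_distrib distrib_left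
        mult.left_commute)
qed

lemma circ_integral_cong:
  assumes "\<And>z. norm z = 1 \<Longrightarrow> f z = g z"
  shows "circ_integral \<mu> f = circ_integral \<mu> g"
  unfolding circ_integral_def cm_integral_def
  using assms by (intro arg_cong2[where f="(+)"] arg_cong2[where f="(-)"] arg_cong2[where f="(*)"] refl
      Bochner_Integration.integral_cong) (auto simp: space_jordan_pos space_circle)

section \<open>Pairing polynomials with a moment sequence\<close>

definition poly_of_coeffs :: "nat \<Rightarrow> (nat \<Rightarrow> 'a::comm_monoid_add) \<Rightarrow> 'a poly" where
  "poly_of_coeffs n f = (\<Sum>i<n. monom (f i) i)"

lemma coeff_poly_of_coeffs: "coeff (poly_of_coeffs n f) i = (if i < n then f i else 0)"
  unfolding poly_of_coeffs_def by (simp add: coeff_sum)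

lemma poly_poly_of_coeffs: "poly (poly_of_coeffs n f) x = (\<Sum>i<n. f i * x ^ i)"
  for f :: "nat \<Rightarrow> 'a::comm_semiring_1"
  unfolding poly_of_coeffs_def by (simp add: poly_sum poly_monom)

text \<open>
  For the moments \<open>c\<close> of \<open>\<mu>\<close> this is the integral of \<open>p(z) z\<^sup>-\<^sup>s\<close>.
\<close>

definition moment_pairing :: "(int \<Rightarrow> complex) \<Rightarrow> complex poly \<Rightarrow> int \<Rightarrow> complex" where
  "moment_pairing c p s = (\<Sum>i\<le>degree p. coeff p i * c (int i - s))"

lemma moment_pairing_bound:
  assumes "\<And>i. n \<le> i \<Longrightarrow> coeff p i = 0"
  shows "moment_pairing c p s = (\<Sum>i<n. coeff p i * c (int i - s))"
proof -
  have "i < n" if "coeff p i \<noteq> 0" for i using assms that by (meson not_le)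
  then show ?thesis unfolding moment_pairing_def
    by (intro sum.mono_neutral_cong) (auto intro: le_degree)
qed

lemma moment_pairing_pCons:
  "moment_pairing c (pCons a p) s = a * c (- s) + moment_pairing c p (s - 1)"
proof -
  have 1: "moment_pairing c (pCons a p) s
      = (\<Sum>i<Suc (Suc (degree p)). coeff (pCons a p) i * c (int i - s))"
    by (rule moment_pairing_bound) (simp add: coeff_eq_0 coeff_pCons split: nat.split)
  have 2: "moment_pairing c p (s - 1) = (\<Sum>i<Suc (degree p). coeff p i * c (int i - (s - 1)))"
    by (rule moment_pairing_bound) (simp add: coeff_eq_0)
  show ?thesis unfolding 1 2 by (subst sum.lessThan_Suc_shift) (simp add: algebra_simps)
qed

lemma moment_pairing_add: "moment_pairing c (p + q) s = moment_pairing c p s + moment_pairing c q s"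
proof -
  define n where "n = Suc (max (degree p) (degree q))"
  have "moment_pairing c r s = (\<Sum>i<n. coeff r i * c (int i - s))" if "r \<in> {p, q, p + q}" for r
    using that by (intro moment_pairing_bound) (auto simp: n_def coeff_eq_0)
  then show ?thesis by (simp add: sum.distrib algebra_simps)
qed

lemma moment_pairing_smult: "moment_pairing c (Polynomial.smult a p) s = a * moment_pairing c p s"
proof -
  have "moment_pairing c r s = (\<Sum>i<Suc (degree p). coeff r i * c (int i - s))" if "r \<in> {p, Polynomial.smult a p}" for r
    using that by (intro moment_pairing_bound) (auto simp: coeff_eq_0)
  then show ?thesis by (simp add: sum_distrib_left algebra_simps)
qed

lemma moment_pairing_diff: "moment_pairing c (p - q) s = moment_pairing c p s - moment_pairing c q s"
  using moment_pairing_add[of c p "- q" s] moment_pairing_smult[of c "-1" q s] by simp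

section \<open>Szego polynomials of a quasi-definite moment sequence\<close>

locale quasi_definite_moments =
  fixes c :: "int \<Rightarrow> complex"
  assumes toeplitz_det:
    "Determinant.det (Matrix.mat (Suc n) (Suc n) (\<lambda>(i, j). c (int i - int j))) \<noteq> 0"
begin

abbreviation "pair \<equiv> moment_pairing c"

text \<open>
  In terms of the coefficients of \<open>p\<close> the conditions form a linear system whose matrix is the
  transpose of a Toeplitz matrix of \<open>c\<close>.
\<close>

lemma ex1_pairing:
  "\<exists>!p. (\<forall>i\<ge>n. coeff p i = 0) \<and> (\<forall>j<n. pair p (int j) = b j)"
proof (cases n)
  case 0
  then show ?thesis by (intro ex1I[of _ 0]) (auto simp: poly_eq_iff)
next
  case (Suc m)
  define A where "A = Matrix.mat n n (\<lambda>(i, j). c (int i - int j))"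
  define T where "T = transpose_mat A"
  have T: "T \<in> carrier_mat n n" unfolding T_def A_def by simp
  have "Determinant.det T \<noteq> 0"
    using toeplitz_det[of m] Suc unfolding T_def A_def by (subst Determinant.det_transpose) auto
  from det_non_zero_imp_unit[OF T this, of "()"]
  obtain B where B: "B \<in> carrier_mat n n" "B * T = 1\<^sub>m n" "T * B = 1\<^sub>m n"
    unfolding Units_def ring_mat_def by auto
  have pairing: "Matrix.vec n (\<lambda>j. pair p (int j)) = T *\<^sub>v Matrix.vec n (coeff p)"
    if "\<forall>i\<ge>n. coeff p i = 0" for p
  proof
    fix j assume "j < dim_vec (T *\<^sub>v Matrix.vec n (coeff p))"
    then have "j < n" using T by simp
    moreover have "pair p (int j) = (\<Sum>i<n. coeff p i * c (int i - int j))"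
      by (rule moment_pairing_bound) (use that in auto)
    ultimately show "vec_index (Matrix.vec n (\<lambda>j. pair p (int j))) j =
        vec_index (T *\<^sub>v Matrix.vec n (coeff p)) j"
      by (simp add: T_def A_def scalar_prod_def lessThan_atLeast0 mult.commute)
  qed (use T in simp)
  define v where "v = B *\<^sub>v Matrix.vec n b"
  have v: "v \<in> carrier_vec n" using B unfolding v_def by simp
  define p where "p = poly_of_coeffs n (vec_index v)"
  show ?thesis
  proof (rule ex1I[of _ p], intro conjI)
    show deg: "\<forall>i\<ge>n. coeff p i = 0" unfolding p_def by (simp add: coeff_poly_of_coeffs)
    have "Matrix.vec n (coeff p) = v"
      using v unfolding p_def by (intro eq_vecI) (auto simp: coeff_poly_of_coeffs)
    then have "Matrix.vec n (\<lambda>j. pair p (int j)) = T *\<^sub>v (B *\<^sub>v Matrix.vec n b)"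
      using pairing[OF deg] v_def by simp
    also have "\<dots> = Matrix.vec n b"
      using T B by (subst assoc_mult_mat_vec[symmetric, of _ n n _ n]) auto
    finally show "\<forall>j<n. pair p (int j) = b j"
      by (metis index_vec)
  next
    fix q assume q: "(\<forall>i\<ge>n. coeff q i = 0) \<and> (\<forall>j<n. pair q (int j) = b j)"
    then have "Matrix.vec n b = Matrix.vec n (\<lambda>j. pair q (int j))" by auto
    also have "\<dots> = T *\<^sub>v Matrix.vec n (coeff q)" using pairing q by blast
    finally have "v = B *\<^sub>v (T *\<^sub>v Matrix.vec n (coeff q))" unfolding v_def by simp
    also have "\<dots> = Matrix.vec n (coeff q)"
      using T B by (subst assoc_mult_mat_vec[symmetric, of _ n n _ n]) auto
    finally show "q = p"
      using q unfolding p_def by (auto simp: poly_eq_iff coeff_poly_of_coeffs)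
  qed
qed

lemma pairing_nondegenerate:
  assumes "\<And>i. i \<ge> n \<Longrightarrow> coeff p i = 0" "\<And>j. j < n \<Longrightarrow> pair p (int j) = 0"
  shows "p = 0"
proof -
  have "(\<forall>i\<ge>n. coeff 0 i = 0) \<and> (\<forall>j<n. pair 0 (int j) = 0)"
    by (simp add: moment_pairing_def)
  then show ?thesis using ex1_pairing[of n "\<lambda>_. 0"] assms by blast
qed

text \<open>
  Subtracting the leading term leaves a polynomial of degree less than \<open>n\<close> with prescribed
  pairings.
\<close>

lemma ex1_monic_orthogonal:
  "\<exists>!p. degree p = n \<and> lead_coeff p = 1 \<and> (\<forall>k<n. pair p (int k) = 0)"
proof -
  obtain p where p: "\<And>i. i \<ge> n \<Longrightarrow> coeff p i = 0" "\<And>j. j < n \<Longrightarrow> pair p (int j) = - pair (monom 1 n) (int j)"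
    using ex1_pairing[of n "\<lambda>j. - pair (monom 1 n) (int j)"] by blast
  define P where "P = monom 1 n + p"
  have lead: "coeff P n = 1" using p(1) unfolding P_def by simp
  then have deg: "degree P = n"
    using p(1) unfolding P_def by (intro antisym degree_le le_degree) (auto simp: coeff_monom)
  show ?thesis
  proof (rule ex1I[of _ P])
    show "degree P = n \<and> lead_coeff P = 1 \<and> (\<forall>k<n. pair P (int k) = 0)"
      using deg lead p(2) by (simp add: P_def moment_pairing_add)
  next
    fix q assume q: "degree q = n \<and> lead_coeff q = 1 \<and> (\<forall>k<n. pair q (int k) = 0)"
    have "q - P = 0"
    proof (rule pairing_nondegenerate[of n])
      show "coeff (q - P) i = 0" if "n \<le> i" for i
        using that q deg lead by (cases "i = n") (auto simp: coeff_eq_0)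
      show "pair (q - P) (int j) = 0" if "j < n" for j
        using that q p(2) by (simp add: P_def moment_pairing_add moment_pairing_diff)
    qed
    then show "q = P" by simp
  qed
qed

text \<open>
  Such a polynomial is \<open>1 + z q\<close> with \<open>q\<close> of degree less than \<open>n\<close>, and pairing \<open>z q\<close> with \<open>z\<^sup>-\<^sup>k\<close>
  amounts to pairing \<open>q\<close> with \<open>z\<^sup>1\<^sup>-\<^sup>k\<close>.
\<close>

lemma ex1_normalized_orthogonal:
  "\<exists>!r. degree r \<le> n \<and> coeff r 0 = 1 \<and> (\<forall>k\<in>{1..n}. pair r (int k) = 0)"
proof -
  obtain q where q: "\<And>i. i \<ge> n \<Longrightarrow> coeff q i = 0" "\<And>j. j < n \<Longrightarrow> pair q (int j) = - c (- int (Suc j))"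
    using ex1_pairing[of n "\<lambda>j. - c (- int (Suc j))"] by blast
  show ?thesis
  proof (rule ex1I[of _ "pCons 1 q"], intro conjI ballI)
    show "degree (pCons 1 q) \<le> n"
      using q(1) by (intro degree_le) (auto simp: coeff_pCons split: nat.split)
    show "coeff (pCons 1 q) 0 = 1" by simp
    show "pair (pCons 1 q) (int k) = 0" if k: "k \<in> {1..n}" for k
    proof -
      from k obtain j where "k = Suc j" "j < n" by (cases k) auto
      then show ?thesis using q(2)[of j] by (simp add: moment_pairing_pCons)
    qed
  next
    fix r assume r: "degree r \<le> n \<and> coeff r 0 = 1 \<and> (\<forall>k\<in>{1..n}. pair r (int k) = 0)"
    obtain s where s: "r = pCons 1 s" using r by (cases r) auto
    have "s - q = 0"
    proof (rule pairing_nondegenerate[of n])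
      show "coeff (s - q) i = 0" if "n \<le> i" for i
        using that r q(1) coeff_eq_0[of r "Suc i"] by (auto simp: s)
      show "pair (s - q) (int j) = 0" if "j < n" for j
        using that r q(2)[OF that] bspec[of _ _ "Suc j", of "{1..n}" "\<lambda>k. pair r (int k) = 0"]
        by (auto simp: s moment_pairing_pCons moment_pairing_diff add_eq_0_iff)
    qed
    then show "r = pCons 1 q" by (simp add: s)
  qed
qed

definition P :: "nat \<Rightarrow> complex poly" where
  "P n = (THE p. degree p = n \<and> lead_coeff p = 1 \<and> (\<forall>k<n. pair p (int k) = 0))"

definition R :: "nat \<Rightarrow> complex poly" where
  "R n = (THE r. degree r \<le> n \<and> coeff r 0 = 1 \<and> (\<forall>k\<in>{1..n}. pair r (int k) = 0))"

lemma P_degree: "degree (P n) = n" and P_lead: "coeff (P n) n = 1"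
  and P_orth: "k < n \<Longrightarrow> pair (P n) (int k) = 0"
  using theI'[OF ex1_monic_orthogonal[of n], folded P_def] by auto

lemma R_degree: "degree (R n) \<le> n" and R_const: "coeff (R n) 0 = 1"
  and R_orth: "1 \<le> k \<Longrightarrow> k \<le> n \<Longrightarrow> pair (R n) (int k) = 0"
  using theI'[OF ex1_normalized_orthogonal[of n], folded R_def] by auto

text \<open>
  \<open>a\<close> and \<open>b\<close> are the Verblunsky coefficients of the first kind and the conjugates of those of the
  second kind; \<open>h\<close> turns out to be the diagonal of the upper triangular factor.
\<close>

definition a :: "nat \<Rightarrow> complex" where "a n = coeff (P n) 0"
definition b :: "nat \<Rightarrow> complex" where "b n = coeff (R n) n"
definition h :: "nat \<Rightarrow> complex" where "h n = pair (P n) (int n)"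

lemma P_0: "P 0 = 1"
  using P_degree[of 0] P_lead[of 0] by (auto simp: poly_eq_iff coeff_eq_0 split: nat.split)

lemma R_0: "R 0 = 1"
  using R_degree[of 0] R_const[of 0] by (auto simp: poly_eq_iff coeff_eq_0)

text \<open>
  Otherwise \<open>P n\<close>, of degree \<open>n\<close>, would be orthogonal to all of \<open>1, \<dots>, z\<^sup>n\<close> and so vanish.
\<close>

lemma h_nonzero: "h n \<noteq> 0"
proof
  assume "h n = 0"
  then have "P n = 0"
    using P_orth[of _ n] P_degree[of n] unfolding h_def
    by (intro pairing_nondegenerate[of "Suc n"]) (auto simp: coeff_eq_0 less_Suc_eq)
  then show False using P_lead[of n] by simp
qed

text \<open>
  The difference of the two sides is \<open>z q\<close> with \<open>q\<close> of degree less than \<open>n\<close>: the leading terms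
  cancel, and so do the constant ones by the choice of \<open>a\<close>. Moreover \<open>z q\<close> is orthogonal to
  \<open>z, \<dots>, z\<^sup>n\<close>, that is, \<open>q\<close> is orthogonal to \<open>1, \<dots>, z\<^sup>n\<^sup>-\<^sup>1\<close>.
\<close>

lemma szego_recursion_P: "P (Suc n) = pCons 0 (P n) + Polynomial.smult (a (Suc n)) (R n)"
proof -
  define D where "D = P (Suc n) - pCons 0 (P n) - Polynomial.smult (a (Suc n)) (R n)"
  have "coeff D 0 = 0" unfolding D_def a_def by (simp add: R_const)
  then obtain q where q: "D = pCons 0 q" by (cases D) simp
  have "q = 0"
  proof (rule pairing_nondegenerate[of n])
    fix i assume "n \<le> i"
    then have "coeff D (Suc i) = 0"
      using P_degree[of "Suc n"] P_lead[of "Suc n"] P_degree[of n] P_lead[of n] R_degree[of n]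
      unfolding D_def by (cases "i = n") (auto simp: coeff_eq_0)
    then show "coeff q i = 0" by (simp add: q)
  next
    fix j assume "j < n"
    then have "pair D (int (Suc j)) = 0"
      using P_orth[of "Suc j" "Suc n"] P_orth[of j n] R_orth[of "Suc j" n]
      unfolding D_def by (simp add: moment_pairing_diff moment_pairing_smult moment_pairing_pCons)
    then show "pair q (int j) = 0" by (simp add: q moment_pairing_pCons)
  qed
  then show ?thesis using q unfolding D_def by (simp add: algebra_simps)
qed

text \<open>
  The same argument, with the coefficients of \<open>z\<^sup>n\<^sup>+\<^sup>1\<close> cancelling by the choice of \<open>b\<close>.
\<close>

lemma szego_recursion_R: "R (Suc n) = R n + Polynomial.smult (b (Suc n)) (pCons 0 (P n))"
proof -
  define D where "D = R (Suc n) - R n - Polynomial.smult (b (Suc n)) (pCons 0 (P n))"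
  have "coeff D 0 = 0" unfolding D_def by (simp add: R_const)
  then obtain q where q: "D = pCons 0 q" by (cases D) simp
  have "q = 0"
  proof (rule pairing_nondegenerate[of n])
    fix i assume "n \<le> i"
    then have "coeff D (Suc i) = 0"
      using R_degree[of "Suc n"] P_degree[of n] P_lead[of n] R_degree[of n]
      unfolding D_def b_def by (cases "i = n") (auto simp: coeff_eq_0)
    then show "coeff q i = 0" by (simp add: q)
  next
    fix j assume "j < n"
    then have "pair D (int (Suc j)) = 0"
      using R_orth[of "Suc j" "Suc n"] P_orth[of j n] R_orth[of "Suc j" n]
      unfolding D_def by (simp add: moment_pairing_diff moment_pairing_smult moment_pairing_pCons)
    then show "pair q (int j) = 0" by (simp add: q moment_pairing_pCons)
  qed
  then show ?thesis using q unfolding D_def by (simp add: algebra_simps)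
qed

text \<open>
  Pair the recursion for \<open>P\<close> with \<open>z\<close> to the power \<open>-(n+1)\<close>; the pairing of \<open>R n\<close> that
  appears is found from the recursion for \<open>R\<close>, whose left-hand side is orthogonal to \<open>z\<^sup>n\<^sup>+\<^sup>1\<close>.
\<close>

lemma h_Suc: "h (Suc n) = h n * (1 - a (Suc n) * b (Suc n))"
proof -
  have "0 = pair (R (Suc n)) (int (Suc n))" using R_orth[of "Suc n" "Suc n"] by simp
  also have "\<dots> = pair (R n) (int (Suc n)) + b (Suc n) * h n"
    unfolding szego_recursion_R[of n] h_def
    by (simp add: moment_pairing_add moment_pairing_smult moment_pairing_pCons)
  finally have "pair (R n) (int (Suc n)) = - b (Suc n) * h n" by (simp add: eq_neg_iff_add_eq_0)
  moreover have "h (Suc n) = h n + a (Suc n) * pair (R n) (int (Suc n))"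
    unfolding h_def szego_recursion_P[of n]
    by (simp add: moment_pairing_add moment_pairing_smult moment_pairing_pCons)
  ultimately show ?thesis by (simp add: algebra_simps)
qed

text \<open>
  Both sides are \<open>c 0\<close> for \<open>n = 0\<close> and satisfy the recursion of \<open>h_Suc\<close>. This is
  why the even and the odd diagonal entries of the upper triangular factor are given by one
  formula.
\<close>

lemma h_eq_pairing_R: "pair (R n) 0 = h n"
proof (induction n)
  case 0
  then show ?case by (simp add: h_def P_0 R_0)
next
  case (Suc n)
  have "0 = pair (P (Suc n)) 0" using P_orth[of 0 "Suc n"] by simp
  also have "\<dots> = pair (P n) (-1) + a (Suc n) * h n"
    unfolding szego_recursion_P[of n]
    by (simp add: moment_pairing_add moment_pairing_smult moment_pairing_pCons Suc)
  finally have "pair (P n) (-1) = - a (Suc n) * h n" by (simp add: eq_neg_iff_add_eq_0)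
  then show ?case
    unfolding szego_recursion_R[of n] h_Suc
    by (simp add: moment_pairing_add moment_pairing_smult moment_pairing_pCons Suc algebra_simps)
qed

end

section \<open>Semi-infinite matrices\<close>

text \<open>
  Products of such matrices are entrywise finite sums, which is what makes them associative.
\<close>

definition row_finite :: "semimat \<Rightarrow> bool" where
  "row_finite A \<longleftrightarrow> (\<forall>i. \<exists>n. \<forall>k\<ge>n. A i k = 0)"

lemma sm_mult_row:
  assumes "\<And>k. n \<le> k \<Longrightarrow> A i k = 0"
  shows "sm_mult A B i j = (\<Sum>k<n. A i k * B k j)"
  unfolding sm_mult_def by (rule suminf_finite) (use assms in auto)

lemma sm_lower_mult:
  assumes "sm_lower A"
  shows "sm_mult A B i j = (\<Sum>k<Suc i. A i k * B k j)"
  by (rule sm_mult_row) (use assms in \<open>auto simp: sm_lower_def\<close>)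

lemma row_finite_lower: "sm_lower A \<Longrightarrow> row_finite A"
  unfolding sm_lower_def row_finite_def by (meson Suc_le_eq)

lemma sm_mult_assoc:
  assumes "row_finite A" "row_finite B"
  shows "sm_mult (sm_mult A B) C = sm_mult A (sm_mult B C)"
proof (intro ext)
  fix i j
  obtain n where n: "\<And>k. n \<le> k \<Longrightarrow> A i k = 0"
    using assms(1) unfolding row_finite_def by blast
  obtain f where f: "\<And>k l. f k \<le> l \<Longrightarrow> B k l = 0"
    using assms(2) unfolding row_finite_def by metis
  define m where "m = Max (insert 0 (f ` {..<n}))"
  have m: "B k l = 0" if "k < n" "m \<le> l" for k l
  proof -
    have "f k \<le> m" unfolding m_def using that(1) by (intro Max_ge) auto
    then show ?thesis using f that(2) by (meson order_trans)
  qed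
  have AB: "sm_mult A B i l = (\<Sum>k<n. A i k * B k l)" for l
    by (rule sm_mult_row) (rule n)
  have "sm_mult (sm_mult A B) C i j = (\<Sum>l<m. sm_mult A B i l * C l j)"
    by (rule sm_mult_row) (simp add: AB m)
  also have "\<dots> = (\<Sum>k<n. \<Sum>l<m. A i k * (B k l * C l j))"
    unfolding AB sum_distrib_right by (subst sum.swap) (simp add: mult.assoc)
  also have "\<dots> = (\<Sum>k<n. A i k * sm_mult B C k j)"
  proof (intro sum.cong refl)
    fix k assume "k \<in> {..<n}"
    then have "sm_mult B C k j = (\<Sum>l<m. B k l * C l j)"
      by (intro sm_mult_row m) auto
    then show "(\<Sum>l<m. A i k * (B k l * C l j)) = A i k * sm_mult B C k j"
      by (simp add: sum_distrib_left)
  qed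
  also have "\<dots> = sm_mult A (sm_mult B C) i j"
    by (rule sm_mult_row[symmetric]) (rule n)
  finally show "sm_mult (sm_mult A B) C i j = sm_mult A (sm_mult B C) i j" .
qed

lemma sm_mult_one_left: "sm_mult sm_one A = A"
proof (intro ext)
  fix i j
  have "sm_mult sm_one A i j = (\<Sum>k<Suc i. sm_one i k * A k j)"
    by (rule sm_mult_row) (auto simp: sm_one_def)
  also have "\<dots> = (\<Sum>k<Suc i. if i = k then A k j else 0)"
    by (intro sum.cong refl) (simp add: sm_one_def)
  also have "\<dots> = A i j" by (subst sum.delta') auto
  finally show "sm_mult sm_one A i j = A i j" .
qed

lemma sm_mult_one_right: "sm_mult A sm_one = A"
proof (intro ext)
  fix i j
  have "sm_mult A sm_one i j = (\<Sum>k\<in>{j}. A i k * sm_one k j)"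
    unfolding sm_mult_def by (rule suminf_finite) (auto simp: sm_one_def)
  then show "sm_mult A sm_one i j = A i j" by (simp add: sm_one_def)
qed

text \<open>
  Forward substitution for \<open>A B = 1\<close>, row by row, with the diagonal of \<open>A\<close> taken to be 1.
\<close>

function lower_right_inverse :: "semimat \<Rightarrow> semimat" where
  "lower_right_inverse A i j = (if i = j then 1 else 0) - (\<Sum>k<i. A i k * lower_right_inverse A k j)"
  by auto
termination by (relation "Wellfounded.measure (\<lambda>(A, i, j). i)") auto

declare lower_right_inverse.simps [simp del]

lemma lower_right_inverse:
  assumes "sm_lower_unitri A"
  shows "sm_lower_unitri (lower_right_inverse A)" "sm_mult A (lower_right_inverse A) = sm_one"
proof -
  have upper: "lower_right_inverse A i j = 0" if "i < j" for i j
    using that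
  proof (induction i rule: less_induct)
    case (less i)
    then show ?case by (subst lower_right_inverse.simps) simp
  qed
  moreover have "lower_right_inverse A i i = 1" for i
    by (subst lower_right_inverse.simps) (simp add: upper)
  ultimately show "sm_lower_unitri (lower_right_inverse A)"
    unfolding sm_lower_unitri_def sm_lower_def by blast
  show "sm_mult A (lower_right_inverse A) = sm_one"
  proof (intro ext)
    fix i j
    have "sm_mult A (lower_right_inverse A) i j =
        (\<Sum>k<i. A i k * lower_right_inverse A k j) + A i i * lower_right_inverse A i j"
      using assms unfolding sm_lower_unitri_def by (simp add: sm_lower_mult)
    also have "\<dots> = sm_one i j"
      using assms unfolding sm_lower_unitri_def sm_one_def
      by (subst (2) lower_right_inverse.simps) simp
    finally show "sm_mult A (lower_right_inverse A) i j = sm_one i j" .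
  qed
qed

text \<open>
  The right inverse \<open>B\<close> of \<open>A\<close> is itself lower unitriangular and so has a right inverse \<open>C\<close>; then
  \<open>A = A (B C) = C\<close>, and \<open>B\<close> is a two-sided inverse of \<open>A\<close>.
\<close>

lemma sm_inv_lower_unitri:
  assumes A: "sm_lower_unitri A"
  shows "sm_lower (sm_inv A)" "sm_mult A (sm_inv A) = sm_one" "sm_mult (sm_inv A) A = sm_one"
proof -
  define B where "B = lower_right_inverse A"
  define C where "C = lower_right_inverse B"
  have B: "sm_lower_unitri B" "sm_mult A B = sm_one"
    unfolding B_def using lower_right_inverse[OF A] by blast+
  have C: "sm_mult B C = sm_one"
    unfolding C_def using lower_right_inverse[OF B(1)] by blast
  have rf: "row_finite A" "row_finite B"
    using A B unfolding sm_lower_unitri_def by (auto intro: row_finite_lower)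
  have "A = sm_mult A (sm_mult B C)" by (simp add: C sm_mult_one_right)
  also have "\<dots> = C" using sm_mult_assoc[OF rf, of C] by (simp add: B sm_mult_one_left)
  finally have BA: "sm_mult B A = sm_one" using C by simp
  have "\<exists>!B. sm_lower B \<and> sm_mult A B = sm_one \<and> sm_mult B A = sm_one"
  proof (rule ex1I[of _ B])
    show "sm_lower B \<and> sm_mult A B = sm_one \<and> sm_mult B A = sm_one"
      using B BA unfolding sm_lower_unitri_def by blast
  next
    fix D assume D: "sm_lower D \<and> sm_mult A D = sm_one \<and> sm_mult D A = sm_one"
    have "D = sm_mult (sm_mult B A) D" by (simp add: BA sm_mult_one_left)
    also have "\<dots> = sm_mult B (sm_mult A D)" by (rule sm_mult_assoc[OF rf(2,1)])
    finally show "D = B" using D by (simp add: sm_mult_one_right)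
  qed
  from theI'[OF this, folded sm_inv_def]
  show "sm_lower (sm_inv A)" "sm_mult A (sm_inv A) = sm_one" "sm_mult (sm_inv A) A = sm_one"
    by blast+
qed

section \<open>The CMV ordering\<close>

definition cmv_exponent :: "nat \<Rightarrow> int" where
  "cmv_exponent k = (if even k then int (k div 2) else - int (Suc k div 2))"

lemma chi_eq_powi: "chi z k = z powi cmv_exponent k"
  by (simp add: chi_def cmv_exponent_def)

text \<open>
  The exponents of the first \<open>n\<close> entries of \<open>\<chi>\<close> are the integers from \<open>- (n div 2)\<close> to
  \<open>n - 1 - n div 2\<close>; shifted by \<open>n div 2\<close> they run through \<open>0, \<dots>, n - 1\<close>.
\<close>

definition cmv_index :: "nat \<Rightarrow> nat \<Rightarrow> nat" where
  "cmv_index n k = nat (cmv_exponent k + int (n div 2))"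

lemma int_cmv_index: "k < n \<Longrightarrow> int (cmv_index n k) = cmv_exponent k + int (n div 2)"
  unfolding cmv_index_def cmv_exponent_def by simp presburger

lemma cmv_index_less: "k < n \<Longrightarrow> cmv_index n k < n"
  unfolding cmv_index_def cmv_exponent_def by (auto elim!: evenE oddE)

lemma inj_cmv_exponent: "inj cmv_exponent"
  unfolding inj_def cmv_exponent_def by (auto elim!: evenE oddE split: if_splits)

lemma bij_cmv_index: "bij_betw (cmv_index n) {..<n} {..<n}"
proof -
  have "inj_on (cmv_index n) {..<n}"
    using inj_cmv_exponent int_cmv_index
    by (intro inj_onI) (metis add_right_cancel injD lessThan_iff)
  moreover have "cmv_index n ` {..<n} \<subseteq> {..<n}" using cmv_index_less by auto
  ultimately show ?thesis
    unfolding bij_betw_def using endo_inj_surj[of "{..<n}"] by auto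
qed

lemma cmv_index_surj:
  assumes "i < n"
  obtains k where "k < n" "i = cmv_index n k"
  using bij_cmv_index[of n] assms unfolding bij_betw_def by (metis imageE lessThan_iff)

lemma cmv_index_eq_iff: "j < n \<Longrightarrow> k < n \<Longrightarrow> cmv_index n j = cmv_index n k \<longleftrightarrow> j = k"
  using bij_cmv_index[of n] unfolding bij_betw_def inj_on_def by auto

text \<open>
  The combination of the first \<open>n\<close> entries of \<open>\<chi>\<close> with coefficients \<open>x\<close>, multiplied by the least
  power of \<open>z\<close> that makes it a polynomial for every \<open>x\<close>.
\<close>

definition row_poly :: "nat \<Rightarrow> (nat \<Rightarrow> complex) \<Rightarrow> complex poly" where
  "row_poly n x = (\<Sum>k<n. monom (x k) (cmv_index n k))"

lemma coeff_row_poly: "k < n \<Longrightarrow> coeff (row_poly n x) (cmv_index n k) = x k"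
  unfolding row_poly_def by (simp add: coeff_sum cmv_index_eq_iff cong: sum.cong_simp)

lemma coeff_row_poly_ge: "n \<le> i \<Longrightarrow> coeff (row_poly n x) i = 0"
  unfolding row_poly_def by (auto simp: coeff_sum dest: cmv_index_less intro!: sum.neutral)

lemma row_poly_eqI:
  assumes "\<And>k. k < n \<Longrightarrow> coeff p (cmv_index n k) = x k" "\<And>i. n \<le> i \<Longrightarrow> coeff p i = 0"
  shows "row_poly n x = p"
proof (rule poly_eqI)
  fix i show "coeff (row_poly n x) i = coeff p i"
  proof (cases "i < n")
    case True
    then obtain k where "k < n" "i = cmv_index n k" by (rule cmv_index_surj)
    then show ?thesis using assms(1) by (simp add: coeff_row_poly)
  qed (use assms(2) in \<open>simp add: coeff_row_poly_ge\<close>)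
qed

lemma poly_row_poly:
  assumes "z \<noteq> 0"
  shows "poly (row_poly n x) z = z ^ (n div 2) * (\<Sum>k<n. x k * chi z k)"
proof -
  have "z ^ cmv_index n k = z ^ (n div 2) * chi z k" if "k < n" for k
  proof -
    have "z ^ cmv_index n k = z powi int (cmv_index n k)" by simp
    also have "\<dots> = z powi cmv_exponent k * z powi int (n div 2)"
      unfolding int_cmv_index[OF that] using assms by (intro power_int_add) auto
    finally show ?thesis by (simp add: chi_eq_powi)
  qed
  then show ?thesis
    unfolding row_poly_def by (simp add: poly_sum poly_monom sum_distrib_left mult.left_commute)
qed

lemma moment_pairing_row_poly:
  "moment_pairing c (row_poly n x) s = (\<Sum>k<n. x k * c (cmv_exponent k + int (n div 2) - s))"
proof -
  have "moment_pairing c (row_poly n x) s = (\<Sum>i<n. coeff (row_poly n x) i * c (int i - s))"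
    by (rule moment_pairing_bound) (rule coeff_row_poly_ge)
  also have "\<dots> = (\<Sum>k<n. coeff (row_poly n x) (cmv_index n k) * c (int (cmv_index n k) - s))"
    by (rule sum.reindex_bij_betw[OF bij_cmv_index, symmetric])
  finally show ?thesis by (simp add: coeff_row_poly int_cmv_index)
qed

lemma chi_linearly_independent:
  assumes "\<And>z. z \<noteq> 0 \<Longrightarrow> (\<Sum>k<n. x k * chi z k) = (\<Sum>k<n. y k * chi z k)" "k < n"
  shows "x k = y k"
proof -
  have "poly (row_poly n x - row_poly n y) z = 0" if "z \<noteq> 0" for z
    using assms(1)[OF that] by (simp add: poly_row_poly[OF that])
  then have "- {0} \<subseteq> {z. poly (row_poly n x - row_poly n y) z = 0}" by auto
  moreover have "infinite (- {0 :: complex})" by (simp add: Compl_eq_Diff_UNIV infinite_UNIV_char_0)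
  ultimately have "row_poly n x - row_poly n y = 0"
    by (metis poly_roots_finite infinite_super)
  then show ?thesis using coeff_row_poly[OF assms(2)] by (metis eq_iff_diff_eq_0)
qed

text \<open>
  A sum up to \<open>i + 2\<close> suffices because \<open>\<Upsilon>\<close> moves an index by at most 2.
\<close>

lemma Upsilon_chi:
  assumes "z \<noteq> 0" "i + 3 \<le> n"
  shows "(\<Sum>k<n. Upsilon i k * chi z k) = z * chi z i"
proof -
  define t where "t = (if even i then i + 2 else if i = 1 then 0 else i - 2)"
  have "Upsilon i k = (if k = t then 1 else 0)" for k
    unfolding Upsilon_def t_def by (auto elim!: oddE)
  then have "(\<Sum>k<n. Upsilon i k * chi z k) = (\<Sum>k<n. if k = t then chi z k else 0)"
    by (intro sum.cong) auto
  also have "\<dots> = chi z t" using assms(2) unfolding t_def by (subst sum.delta) auto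
  also have "\<dots> = z powi (1 + cmv_exponent i)"
  proof -
    have "cmv_exponent t = 1 + cmv_exponent i"
      unfolding t_def cmv_exponent_def by simp presburger
    then show ?thesis by (simp add: chi_eq_powi)
  qed
  finally show ?thesis using assms(1) by (simp add: chi_eq_powi power_int_add)
qed

section \<open>Triangular factorization of the moment matrix\<close>

context quasi_definite_moments
begin

text \<open>
  The polynomial that row \<open>l\<close> of the lower triangular factor turns out to represent: in \<open>\<phi>\<^sub>l\<close> the
  normalized entry \<open>\<chi>\<^sub>l\<close> carries the highest power of \<open>z\<close> for even \<open>l\<close> and the lowest one for odd \<open>l\<close>.
\<close>

definition cmv_poly :: "nat \<Rightarrow> complex poly" where "cmv_poly l = (if even l then P l else R l)"

definition S :: semimat where
  "S l k = (if k \<le> l then coeff (cmv_poly l) (cmv_index (Suc l) k) else 0)"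

definition gram :: semimat where "gram i j = c (cmv_exponent i - cmv_exponent j)"

lemma row_poly_S: "row_poly (Suc l) (S l) = cmv_poly l"
proof (rule row_poly_eqI)
  show "coeff (cmv_poly l) i = 0" if "Suc l \<le> i" for i
    using that P_degree[of l] R_degree[of l] unfolding cmv_poly_def by (auto simp: coeff_eq_0)
qed (simp add: S_def)

lemma S_lower_unitri: "sm_lower_unitri S"
proof -
  have "cmv_index (Suc l) l = (if even l then l else 0)" for l
    unfolding cmv_index_def cmv_exponent_def by (auto elim!: evenE)
  then show ?thesis
    unfolding sm_lower_unitri_def sm_lower_def by (auto simp: S_def cmv_poly_def P_lead R_const)
qed

lemma S_gram: "sm_mult S gram l j = pair (cmv_poly l) (cmv_exponent j + int (Suc l div 2))"
proof -
  have "sm_lower S" using S_lower_unitri sm_lower_unitri_def by blast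
  then show ?thesis
    unfolding row_poly_S[symmetric] moment_pairing_row_poly
    by (simp only: sm_lower_mult) (simp add: gram_def)
qed

text \<open>
  The entries of \<open>\<chi>\<close> before \<open>\<chi>\<^sub>l\<close> are, after the shift by \<open>Suc l div 2\<close>, the powers
  \<open>1, \<dots>, z\<^sup>l\<^sup>-\<^sup>1\<close> for even \<open>l\<close> and \<open>z, \<dots>, z\<^sup>l\<close> for odd \<open>l\<close>: just the ones to which \<open>P l\<close> and
  \<open>R l\<close> are orthogonal.
\<close>

lemma S_gram_upper: "sm_upper (sm_mult S gram)"
  unfolding sm_upper_def
proof (intro allI impI)
  fix l j :: nat assume j: "j < l"
  define i where "i = cmv_index l j"
  have i: "i < l" "int i = cmv_exponent j + int (l div 2)"
    unfolding i_def using cmv_index_less[OF j] int_cmv_index[OF j] by auto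
  show "sm_mult S gram l j = 0"
  proof (cases "even l")
    case True
    then have "cmv_exponent j + int (Suc l div 2) = int i" using i by simp
    then show ?thesis using True P_orth[OF i(1)] by (simp add: S_gram cmv_poly_def)
  next
    case False
    then have "cmv_exponent j + int (Suc l div 2) = int (Suc i)" using i by (auto elim!: oddE)
    then show ?thesis using False R_orth[of "Suc i" l] i(1) by (simp only: S_gram cmv_poly_def) simp
  qed
qed

lemma S_gram_diag: "sm_mult S gram l l = h l"
proof (cases "even l")
  case True
  then have "cmv_exponent l + int (Suc l div 2) = int l"
    unfolding cmv_exponent_def by (auto elim!: evenE)
  then show ?thesis using True by (simp add: S_gram cmv_poly_def h_def)
next
  case False
  then show ?thesis by (simp add: S_gram cmv_poly_def h_eq_pairing_R cmv_exponent_def)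
qed

lemma gram_eq_factors: "gram = sm_mult (sm_inv S) (sm_mult S gram)"
proof -
  note inv = sm_inv_lower_unitri[OF S_lower_unitri]
  have "row_finite (sm_inv S)" "row_finite S"
    using inv S_lower_unitri unfolding sm_lower_unitri_def by (auto intro: row_finite_lower)
  from sm_mult_assoc[OF this, of gram] show ?thesis by (simp add: inv sm_mult_one_left)
qed

text \<open>
  The difference of the rows with number \<open>l\<close> of \<open>A\<close> and \<open>S\<close> has no entry in column \<open>l\<close> or later,
  and its product with \<open>gram\<close> vanishes in the columns before \<open>l\<close>; so its row polynomial, of degree
  less than \<open>l\<close>, is orthogonal to \<open>1, \<dots>, z\<^sup>l\<^sup>-\<^sup>1\<close>.
\<close>

lemma factorization_unique:
  assumes A: "sm_lower_unitri A" and U: "sm_upper U" and gram: "gram = sm_mult (sm_inv A) U"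
  shows "A = S" "U = sm_mult S gram"
proof -
  note inv = sm_inv_lower_unitri[OF A]
  have "row_finite (sm_inv A)" "row_finite A"
    using inv A unfolding sm_lower_unitri_def by (auto intro: row_finite_lower)
  from sm_mult_assoc[OF this(2,1), of U] have U_eq: "sm_mult A gram = U"
    by (simp add: inv sm_mult_one_left gram)
  have row: "A l k = S l k" if "k < l" for l k
  proof -
    define p where "p = row_poly l (\<lambda>k. A l k - S l k)"
    have lower: "sm_lower A" "sm_lower S" "A l l = S l l"
      using A S_lower_unitri unfolding sm_lower_unitri_def by auto
    have "p = 0"
    proof (rule pairing_nondegenerate)
      show "coeff p i = 0" if "l \<le> i" for i using that unfolding p_def by (rule coeff_row_poly_ge)
    next
      fix i assume "i < l"
      then obtain j where j: "j < l" "i = cmv_index l j" by (rule cmv_index_surj)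
      have "pair p (int i) = (\<Sum>k<l. (A l k - S l k) * gram k j)"
        unfolding p_def moment_pairing_row_poly j(2) int_cmv_index[OF j(1)]
        by (simp add: gram_def)
      also have "\<dots> = sm_mult A gram l j - sm_mult S gram l j"
        by (simp add: sm_lower_mult lower left_diff_distrib sum_subtractf)
      also have "\<dots> = 0"
        using U S_gram_upper j(1) unfolding U_eq sm_upper_def by simp
      finally show "pair p (int i) = 0" .
    qed
    then show ?thesis using coeff_row_poly[OF that, of "\<lambda>k. A l k - S l k"] unfolding p_def by simp
  qed
  have "A l k = S l k" for l k
    using row[of k l] A S_lower_unitri unfolding sm_lower_unitri_def sm_lower_def
    by (cases k l rule: linorder_cases) auto
  then show "A = S" by blast
  then show "U = sm_mult S gram" using U_eq by simp
qed

end

section \<open>The cmv_jacobiobi type matrix and the recursion relations\<close>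

context quasi_definite_moments
begin

definition phi :: "nat \<Rightarrow> complex \<Rightarrow> complex" where
  "phi l z = (\<Sum>k<Suc l. S l k * chi z k)"

definition rho :: "nat \<Rightarrow> complex" where
  "rho l = (if l = 0 then 0 else h l / h (l - 1))"

lemma rho_Suc: "rho (Suc n) = 1 - a (Suc n) * b (Suc n)"
  using h_nonzero[of n] by (simp add: rho_def h_Suc)

lemma b_0: "b 0 = 1"
  by (simp add: b_def R_0)

lemma phi_eq_poly: "z \<noteq> 0 \<Longrightarrow> phi l z = poly (cmv_poly l) z / z ^ (Suc l div 2)"
  using poly_row_poly[of z "Suc l" "S l"] by (simp add: row_poly_S phi_def)

lemma phi_even: "z \<noteq> 0 \<Longrightarrow> phi (2 * k) z = poly (P (2 * k)) z / z ^ k"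
  and phi_odd: "z \<noteq> 0 \<Longrightarrow> phi (2 * k + 1) z = poly (R (2 * k + 1)) z / z ^ (k + 1)"
  by (simp_all add: phi_eq_poly cmv_poly_def)

text \<open>
  Eliminate \<open>z P n\<close> from the two Szego recursions.
\<close>

lemma R_Suc_via_P: "R (Suc n) = Polynomial.smult (rho (Suc n)) (R n) + Polynomial.smult (b (Suc n)) (P (Suc n))"
  unfolding szego_recursion_P szego_recursion_R rho_Suc
  by (simp add: algebra_simps smult_add_right smult_add_left smult_diff_left)

text \<open>
  The case \<open>k = 0\<close> fits in because \<open>P 0 = R 0 = 1\<close>, \<open>b 0 = 1\<close> and \<open>rho 0 = 0\<close>.
\<close>

lemma poly_R_even:
  assumes "z \<noteq> 0"
  shows "poly (R (2 * k)) z / z ^ k =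
    rho (2 * k) * (if k = 0 then 0 else phi (2 * k - 1) z) + b (2 * k) * phi (2 * k) z"
proof (cases k)
  case 0
  then show ?thesis using phi_even[OF assms, of 0] by (simp add: P_0 R_0 b_0 rho_def)
next
  case (Suc m)
  have "phi (2 * k - 1) z = poly (R (2 * m + 1)) z / z ^ k"
    using phi_odd[OF assms, of m] Suc by simp
  moreover have "phi (2 * k) z = poly (P (2 * k)) z / z ^ k" by (rule phi_even[OF assms])
  moreover have "poly (R (2 * k)) z = rho (2 * k) * poly (R (2 * m + 1)) z + b (2 * k) * poly (P (2 * k)) z"
    using R_Suc_via_P[of "2 * m + 1"] Suc by simp
  ultimately show ?thesis using Suc by (simp add: add_divide_distrib)
qed

lemma poly_P_odd:
  assumes "z \<noteq> 0"
  shows "poly (P (2 * k + 1)) z / z ^ k = phi (2 * k + 2) z - a (2 * k + 2) * phi (2 * k + 1) z"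
proof -
  have "phi (2 * k + 2) z = poly (P (2 * k + 2)) z / z ^ (k + 1)"
    using phi_even[OF assms, of "k + 1"] by simp
  moreover have "poly (P (2 * k + 2)) z = z * poly (P (2 * k + 1)) z + a (2 * k + 2) * poly (R (2 * k + 1)) z"
    using szego_recursion_P[of "2 * k + 1"] by simp
  ultimately show ?thesis
    unfolding phi_odd[OF assms] using assms by (simp add: add_divide_distrib)
qed

text \<open>
  \<open>z P (2k)\<close> is replaced by \<open>P (2k+1)\<close> and \<open>R (2k)\<close>. Neither of these has the parity of a row
  polynomial, but each is a combination of two neighbouring ones.
\<close>

lemma phi_recursion_even:
  assumes "z \<noteq> 0"
  shows "z * phi (2 * k) z = phi (2 * k + 2) z - a (2 * k + 2) * phi (2 * k + 1) z
    - b (2 * k) * a (2 * k + 1) * phi (2 * k) z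
    - rho (2 * k) * a (2 * k + 1) * (if k = 0 then 0 else phi (2 * k - 1) z)"
proof -
  have "z * poly (P (2 * k)) z = poly (P (2 * k + 1)) z - a (2 * k + 1) * poly (R (2 * k)) z"
    using szego_recursion_P[of "2 * k"] by simp
  then have "z * phi (2 * k) z
      = poly (P (2 * k + 1)) z / z ^ k - a (2 * k + 1) * (poly (R (2 * k)) z / z ^ k)"
    by (simp add: phi_even assms diff_divide_distrib)
  then show ?thesis unfolding poly_P_odd[OF assms] poly_R_even[OF assms] by (simp only: algebra_simps)
qed

lemma phi_recursion_odd:
  assumes "z \<noteq> 0"
  shows "z * phi (2 * k + 1) z = b (2 * k + 1) * phi (2 * k + 2) z
    - b (2 * k + 1) * a (2 * k + 2) * phi (2 * k + 1) z
    + rho (2 * k + 1) * b (2 * k) * phi (2 * k) z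
    + rho (2 * k + 1) * rho (2 * k) * (if k = 0 then 0 else phi (2 * k - 1) z)"
proof -
  have "z * phi (2 * k + 1) z = poly (R (2 * k + 1)) z / z ^ k"
    unfolding phi_odd[OF assms] using assms by simp
  also have "\<dots> = rho (2 * k + 1) * (poly (R (2 * k)) z / z ^ k)
      + b (2 * k + 1) * (poly (P (2 * k + 1)) z / z ^ k)"
    using R_Suc_via_P[of "2 * k"] by (simp add: add_divide_distrib)
  finally show ?thesis unfolding poly_P_odd[OF assms] poly_R_even[OF assms] by (simp only: algebra_simps)
qed

text \<open>
  The coefficients in the two recursions. Entries with a negative column index drop out by
  themselves: no \<open>j\<close> satisfies \<open>Suc j = 0\<close> or \<open>j + 2 = 1\<close>.
\<close>

definition cmv_jacobi :: semimat where
  "cmv_jacobi i j = (if even i then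
      (if Suc j = i then - rho i * a (i + 1) else if j = i then - b i * a (i + 1)
       else if j = i + 1 then - a (i + 2) else if j = i + 2 then 1 else 0)
    else
      (if j + 2 = i then rho i * rho (i - 1) else if Suc j = i then rho i * b (i - 1)
       else if j = i then - b i * a (i + 1) else if j = i + 1 then b i else 0))"

lemma cmv_jacobi_phi:
  assumes "z \<noteq> 0"
  shows "(\<Sum>j<i + 3. cmv_jacobi i j * phi j z) = z * phi i z"
proof (cases "even i")
  case True
  then obtain k where i: "i = 2 * k" by blast
  have "(\<Sum>j<i + 3. cmv_jacobi i j * phi j z) = (\<Sum>j\<in>(if k = 0 then {} else {i - 1}) \<union> {i, i + 1, i + 2}. cmv_jacobi i j * phi j z)"
    using i by (intro sum.mono_neutral_right) (auto simp: cmv_jacobi_def split: if_splits)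
  also have "\<dots> = z * phi i z"
    unfolding i phi_recursion_even[OF assms] by (cases k) (simp_all add: cmv_jacobi_def rho_def)
  finally show ?thesis .
next
  case False
  then obtain k where i: "i = 2 * k + 1" by (rule oddE)
  have "(\<Sum>j<i + 3. cmv_jacobi i j * phi j z) = (\<Sum>j\<in>(if k = 0 then {} else {i - 2}) \<union> {i - 1, i, i + 1}. cmv_jacobi i j * phi j z)"
    using i by (intro sum.mono_neutral_right) (auto simp: cmv_jacobi_def split: if_splits)
  also have "\<dots> = z * phi i z"
    unfolding i phi_recursion_odd[OF assms] by (cases k) (simp_all add: cmv_jacobi_def rho_def)
  finally show ?thesis .
qed

lemma phi_eq_longer_sum: "l < n \<Longrightarrow> phi l z = (\<Sum>k<n. S l k * chi z k)"
  unfolding phi_def by (intro sum.mono_neutral_left) (auto simp: S_def)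

lemma cmv_jacobi_row: "i + 3 \<le> j \<Longrightarrow> cmv_jacobi i j = 0"
  by (simp add: cmv_jacobi_def)

text \<open>
  Applied to \<open>\<chi> z\<close>, both sides give \<open>z \<phi>\<^sub>i(z)\<close> in row \<open>i\<close>; so they agree by linear independence of
  the entries of \<open>\<chi>\<close>.
\<close>

lemma S_Upsilon: "sm_mult S Upsilon = sm_mult cmv_jacobi S"
proof (intro ext)
  fix i m :: nat
  \<comment> \<open>Past column \<open>i + 2\<close> both rows vanish; \<open>m\<close> is added to have column \<open>m\<close> in range.\<close>
  define n where "n = i + m + 3"
  have "sm_lower S" using S_lower_unitri sm_lower_unitri_def by blast
  then have left: "sm_mult S Upsilon i k = (\<Sum>j<Suc i. S i j * Upsilon j k)" for k
    by (rule sm_lower_mult)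
  have right: "sm_mult cmv_jacobi S i k = (\<Sum>j<i + 3. cmv_jacobi i j * S j k)" for k
    by (rule sm_mult_row) (rule cmv_jacobi_row)
  show "sm_mult S Upsilon i m = sm_mult cmv_jacobi S i m"
  proof (rule chi_linearly_independent[where n = n])
    show "m < n" by (simp add: n_def)
    fix z :: complex assume z: "z \<noteq> 0"
    have "(\<Sum>k<n. sm_mult S Upsilon i k * chi z k)
        = (\<Sum>j<Suc i. S i j * (\<Sum>k<n. Upsilon j k * chi z k))"
      unfolding left sum_distrib_right sum_distrib_left
      by (subst sum.swap) (simp add: mult.assoc)
    also have "\<dots> = (\<Sum>j<Suc i. S i j * (z * chi z j))"
      by (intro sum.cong refl) (simp add: Upsilon_chi[OF z] n_def)
    also have "\<dots> = z * phi i z"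
      unfolding phi_def sum_distrib_left by (intro sum.cong refl) simp
    also have "\<dots> = (\<Sum>j<i + 3. cmv_jacobi i j * phi j z)" by (rule cmv_jacobi_phi[OF z, symmetric])
    also have "\<dots> = (\<Sum>j<i + 3. cmv_jacobi i j * (\<Sum>k<n. S j k * chi z k))"
      by (intro sum.cong refl) (simp add: phi_eq_longer_sum[of _ n] n_def)
    also have "\<dots> = (\<Sum>k<n. sm_mult cmv_jacobi S i k * chi z k)"
      unfolding right sum_distrib_right sum_distrib_left
      by (subst sum.swap) (simp add: mult.assoc)
    finally show "(\<Sum>k<n. sm_mult S Upsilon i k * chi z k) = (\<Sum>k<n. sm_mult cmv_jacobi S i k * chi z k)" .
  qed
qed

lemma S_Upsilon_conjugate: "sm_mult (sm_mult S Upsilon) (sm_inv S) = cmv_jacobi"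
proof -
  have "row_finite cmv_jacobi" unfolding row_finite_def using cmv_jacobi_row by blast
  moreover have "row_finite S"
    using S_lower_unitri unfolding sm_lower_unitri_def by (auto intro: row_finite_lower)
  ultimately show ?thesis
    by (simp add: S_Upsilon sm_mult_assoc sm_inv_lower_unitri[OF S_lower_unitri] sm_mult_one_right)
qed

end

section \<open>Quasi-definite measures on the circle\<close>

text \<open>
  \<open>z\<^sup>n\<close> times the value at \<open>1/z\<close> of \<open>p\<close> with conjugated coefficients. The degree
  \<open>n\<close> is a parameter, as opposed to \<open>reflect_poly\<close>, so that the operation is an involution also on
  polynomials with constant term 0.
\<close>

definition reversed :: "nat \<Rightarrow> complex poly \<Rightarrow> complex poly" where
  "reversed n p = poly_of_coeffs (Suc n) (\<lambda>i. cnj (coeff p (n - i)))"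

lemma coeff_reversed: "coeff (reversed n p) i = (if i \<le> n then cnj (coeff p (n - i)) else 0)"
  unfolding reversed_def by (simp add: coeff_poly_of_coeffs less_Suc_eq_le)

lemma reversed_reversed: "degree p \<le> n \<Longrightarrow> reversed n (reversed n p) = p"
  by (auto simp: poly_eq_iff coeff_reversed coeff_eq_0)

definition moment :: "(complex set \<Rightarrow> complex) \<Rightarrow> int \<Rightarrow> complex" where
  "moment \<mu> n = circ_integral \<mu> (\<lambda>z. z powi n)"

lemma continuous_on_powi_circle: "continuous_on (sphere 0 1) (\<lambda>z::complex. z powi n)"
  by (intro continuous_intros) auto

lemma cnj_on_circle: "norm z = 1 \<Longrightarrow> cnj z = inverse z"
  by (metis complex_div_cnj div_by_1 inverse_eq_divide mult_1 of_real_1 one_power2)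

lemma moment_matrix_eq_moment:
  "moment_matrix \<mu> i j = moment \<mu> (cmv_exponent i - cmv_exponent j)"
  unfolding moment_matrix_def moment_def
proof (rule circ_integral_cong)
  fix z :: complex assume z: "norm z = 1"
  then have "z \<noteq> 0" by auto
  then show "chi z i * cnj (chi z j) = z powi (cmv_exponent i - cmv_exponent j)"
    using z by (simp add: chi_eq_powi cnj_on_circle power_int_diff power_int_inverse divide_inverse)
qed

lemma circ_integral_poly:
  assumes "complex_measure circle \<mu>"
  shows "circ_integral \<mu> (\<lambda>z. poly p z * z powi (- s)) = moment_pairing (moment \<mu>) p s"
proof -
  have "circ_integral \<mu> (\<lambda>z. poly p z * z powi (- s))
      = circ_integral \<mu> (\<lambda>z. \<Sum>i\<le>degree p. coeff p i * z powi (int i - s))"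
  proof (rule circ_integral_cong)
    fix z :: complex assume "norm z = 1"
    then have "z \<noteq> 0" by auto
    then have "z powi (int i - s) = z ^ i * z powi (- s)" for i
      using power_int_add[of z "int i" "- s"] by simp
    then show "poly p z * z powi (- s) = (\<Sum>i\<le>degree p. coeff p i * z powi (int i - s))"
      by (simp add: poly_altdef sum_distrib_right mult.assoc)
  qed
  then show ?thesis
    by (simp add: circ_integral_sum[OF assms continuous_on_powi_circle] moment_pairing_def moment_def)
qed

text \<open>
  On the circle, and indeed for \<open>z \<noteq> 0\<close>, the integrand is \<open>reversed n p\<close> times a power of \<open>z\<close>.
\<close>

lemma circ_integral_conjugate_poly:
  assumes cm: "complex_measure circle \<mu>" and p: "degree p \<le> n"
  shows "circ_integral \<mu> (\<lambda>z. z ^ k * poly (map_poly cnj p) (inverse z))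
    = moment_pairing (moment \<mu>) (reversed n p) (int n - int k)"
  unfolding circ_integral_poly[OF cm, symmetric]
proof (rule circ_integral_cong)
  fix z :: complex assume "norm z = 1"
  then have z: "z \<noteq> 0" by auto
  have "poly (map_poly cnj p) (inverse z) = (\<Sum>i\<le>n. cnj (coeff p i) * inverse z ^ i)"
    unfolding poly_altdef using p
    by (intro sum.mono_neutral_cong_left) (auto simp: coeff_map_poly degree_map_poly coeff_eq_0)
  also have "\<dots> = (\<Sum>i\<le>n. cnj (coeff p (n - i)) * inverse z ^ (n - i))"
    by (rule sum.reindex_bij_witness[of _ "\<lambda>i. n - i" "\<lambda>i. n - i"]) auto
  also have "z ^ k * \<dots> = poly (reversed n p) z * z powi (- (int n - int k))"
    unfolding reversed_def poly_poly_of_coeffs sum_distrib_left sum_distrib_right lessThan_Suc_atMost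
  proof (intro sum.cong refl)
    fix i assume "i \<in> {..n}"
    then have "inverse z ^ (n - i) = z ^ i / z ^ n"
      using z by (simp add: power_diff power_inverse field_simps)
    moreover have "z powi (- (int n - int k)) = z ^ k / z ^ n"
      using z power_int_diff[of z "int k" "int n"] by simp
    ultimately show "z ^ k * (cnj (coeff p (n - i)) * inverse z ^ (n - i))
        = cnj (coeff p (n - i)) * z ^ i * z powi (- (int n - int k))" by simp
  qed
  finally show "z ^ k * poly (map_poly cnj p) (inverse z)
    = poly (reversed n p) z * z powi (- (int n - int k))" by simp
qed

locale quasi_definite_measure =
  fixes \<mu> :: "complex set \<Rightarrow> complex"
  assumes cm: "complex_measure circle \<mu>" and qd: "quasi_definite \<mu>"

sublocale quasi_definite_measure \<subseteq> quasi_definite_moments "moment \<mu>"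
  by unfold_locales (use qd in \<open>simp add: quasi_definite_def moment_def\<close>)

context quasi_definite_measure
begin

lemma szego1_eq: "szego1 \<mu> n = P n"
  unfolding szego1_def P_def circ_integral_poly[OF cm] ..

lemma alpha1_eq: "alpha1 \<mu> n = a n"
  by (simp add: alpha1_def szego1_eq a_def poly_0_coeff_0)

lemma szego2_orthogonal_iff:
  assumes "degree p = n"
  shows "(\<forall>k<n. circ_integral \<mu> (\<lambda>z. z ^ k * poly (map_poly cnj p) (inverse z)) = 0)
    \<longleftrightarrow> (\<forall>k\<in>{1..n}. pair (reversed n p) (int k) = 0)"
proof -
  have "circ_integral \<mu> (\<lambda>z. z ^ k * poly (map_poly cnj p) (inverse z))
      = pair (reversed n p) (int (n - k))" if "k < n" for k
    using circ_integral_conjugate_poly[OF cm, of p n k] assms that by (simp add: of_nat_diff)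
  then have "(\<forall>k<n. circ_integral \<mu> (\<lambda>z. z ^ k * poly (map_poly cnj p) (inverse z)) = 0)
    \<longleftrightarrow> (\<forall>k<n. pair (reversed n p) (int (n - k)) = 0)" by simp
  also have "\<dots> \<longleftrightarrow> (\<forall>k\<in>{1..n}. pair (reversed n p) (int k) = 0)"
  proof (intro iffI ballI allI impI)
    fix k assume "\<forall>k<n. pair (reversed n p) (int (n - k)) = 0" "k \<in> {1..n}"
    then show "pair (reversed n p) (int k) = 0" by (auto dest!: spec[of _ "n - k"])
  next
    fix k assume all: "\<forall>k\<in>{1..n}. pair (reversed n p) (int k) = 0" and "k < n"
    then have "n - k \<in> {1..n}" by simp
    with all show "pair (reversed n p) (int (n - k)) = 0" by blast
  qed
  finally show ?thesis .
qed

text \<open>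
  \<open>reversed n\<close> exchanges the leading and the constant coefficient and turns the
  condition with index \<open>k < n\<close> into orthogonality to \<open>z\<^sup>n\<^sup>-\<^sup>k\<close>.
\<close>

lemma szego2_eq: "szego2 \<mu> n = reversed n (R n)"
  unfolding szego2_def
proof (rule the_equality)
  have lead: "coeff (reversed n (R n)) n = 1" by (simp add: coeff_reversed R_const)
  then have deg: "degree (reversed n (R n)) = n"
    by (intro antisym degree_le le_degree) (auto simp: coeff_reversed)
  show "degree (reversed n (R n)) = n \<and> lead_coeff (reversed n (R n)) = 1 \<and>
     (\<forall>k<n. circ_integral \<mu> (\<lambda>z. z ^ k * poly (map_poly cnj (reversed n (R n))) (inverse z)) = 0)"
    unfolding szego2_orthogonal_iff[OF deg] reversed_reversed[OF R_degree]
    using lead deg R_orth by simp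
next
  fix p assume p: "degree p = n \<and> lead_coeff p = 1 \<and>
     (\<forall>k<n. circ_integral \<mu> (\<lambda>z. z ^ k * poly (map_poly cnj p) (inverse z)) = 0)"
  then have orth: "\<forall>k\<in>{1..n}. pair (reversed n p) (int k) = 0"
    using szego2_orthogonal_iff by blast
  have "R n = reversed n p"
    unfolding R_def
  proof (rule the1_equality[OF ex1_normalized_orthogonal], intro conjI)
    show "degree (reversed n p) \<le> n" by (intro degree_le) (simp add: coeff_reversed)
    show "coeff (reversed n p) 0 = 1" using p by (auto simp: coeff_reversed)
  qed (rule orth)
  then show "p = reversed n (R n)" using p by (simp add: reversed_reversed)
qed

lemma cnj_alpha2_eq: "cnj (alpha2 \<mu> n) = b n"
  by (simp add: alpha2_def szego2_eq b_def poly_0_coeff_0 coeff_reversed)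

lemma CMV_factors_eq: "CMV_factors \<mu> = (S, sm_mult S gram)"
proof -
  have gram: "moment_matrix \<mu> = gram"
    by (intro ext) (simp add: moment_matrix_eq_moment gram_def)
  show ?thesis
    unfolding CMV_factors_def gram
  proof (rule the_equality)
    show "case (S, sm_mult S gram) of (S1, S2) \<Rightarrow>
        sm_lower_unitri S1 \<and> sm_upper S2 \<and> gram = sm_mult (sm_inv S1) S2"
      unfolding prod.case using S_lower_unitri S_gram_upper gram_eq_factors by blast
  next
    fix AU assume "case AU of (S1, S2) \<Rightarrow>
        sm_lower_unitri S1 \<and> sm_upper S2 \<and> gram = sm_mult (sm_inv S1) S2"
    then show "AU = (S, sm_mult S gram)"
      using factorization_unique by (cases AU) blast
  qed
qed

lemma CMV_S1_eq: "CMV_S1 \<mu> = S"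
  by (simp add: CMV_S1_def CMV_factors_eq)

lemma rho_sq_eq: "rho_sq \<mu> n = rho n"
  by (simp add: rho_sq_def rho_def CMV_h_def CMV_S2_def CMV_factors_eq S_gram_diag)

lemma phi1_eq: "phi1 \<mu> l z = phi l z"
  unfolding phi1_def phi_def CMV_S1_eq by (rule suminf_finite) (auto simp: S_def)

lemma CMV_J_eq: "CMV_J \<mu> = cmv_jacobi"
  unfolding CMV_J_def CMV_S1_eq by (rule S_Upsilon_conjugate)

end

theorem proposition12:
  fixes \<mu> :: "complex set \<Rightarrow> complex"
  assumes "complex_measure circle \<mu>"
    and "quasi_definite \<mu>"
  shows
    "(\<forall>k j. CMV_J \<mu> (2*k) j \<noteq> 0 \<longrightarrow> int j \<in> {2 * int k - 1 .. 2 * int k + 2}) \<and>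
     (\<forall>k j. CMV_J \<mu> (2*k+1) j \<noteq> 0 \<longrightarrow> int j \<in> {2 * int k - 1 .. 2 * int k + 2}) \<and>
     (\<forall>k. (k \<ge> 1 \<longrightarrow> CMV_J \<mu> (2*k) (2*k-1) = - rho_sq \<mu> (2*k) * alpha1 \<mu> (2*k+1)) \<and>
          CMV_J \<mu> (2*k) (2*k) = - cnj (alpha2 \<mu> (2*k)) * alpha1 \<mu> (2*k+1) \<and>
          CMV_J \<mu> (2*k) (2*k+1) = - alpha1 \<mu> (2*k+2) \<and>
          CMV_J \<mu> (2*k) (2*k+2) = 1 \<and>
          (k \<ge> 1 \<longrightarrow> CMV_J \<mu> (2*k+1) (2*k-1) = rho_sq \<mu> (2*k+1) * rho_sq \<mu> (2*k)) \<and>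
          CMV_J \<mu> (2*k+1) (2*k) = rho_sq \<mu> (2*k+1) * cnj (alpha2 \<mu> (2*k)) \<and>
          CMV_J \<mu> (2*k+1) (2*k+1) = - cnj (alpha2 \<mu> (2*k+1)) * alpha1 \<mu> (2*k+2) \<and>
          CMV_J \<mu> (2*k+1) (2*k+2) = cnj (alpha2 \<mu> (2*k+1))) \<and>
     (\<forall>k z. z \<noteq> 0 \<longrightarrow>
          z * phi1 \<mu> (2*k) z =
            phi1 \<mu> (2*k+2) z
            - alpha1 \<mu> (2*k+2) * phi1 \<mu> (2*k+1) z
            - cnj (alpha2 \<mu> (2*k)) * alpha1 \<mu> (2*k+1) * phi1 \<mu> (2*k) z
            - rho_sq \<mu> (2*k) * alpha1 \<mu> (2*k+1) * (if k = 0 then 0 else phi1 \<mu> (2*k-1) z) \<and>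
          z * phi1 \<mu> (2*k+1) z =
            cnj (alpha2 \<mu> (2*k+1)) * phi1 \<mu> (2*k+2) z
            - cnj (alpha2 \<mu> (2*k+1)) * alpha1 \<mu> (2*k+2) * phi1 \<mu> (2*k+1) z
            + rho_sq \<mu> (2*k+1) * cnj (alpha2 \<mu> (2*k)) * phi1 \<mu> (2*k) z
            + rho_sq \<mu> (2*k+1) * rho_sq \<mu> (2*k) * (if k = 0 then 0 else phi1 \<mu> (2*k-1) z))"
proof -
  interpret quasi_definite_measure \<mu> by unfold_locales (rule assms)+
  show ?thesis
    unfolding alpha1_eq cnj_alpha2_eq rho_sq_eq phi1_eq CMV_J_eq
    using phi_recursion_even phi_recursion_odd
    by (intro conjI allI impI) (auto simp: cmv_jacobi_def split: if_splits)
qed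

end
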